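(* Let $(\alpha_0',\beta_0')\in\mathbb{R}^2$ and suppose that $\alpha,\beta\in C^\infty(\mathbb{R})$, $\alpha>0$, solve the initial value problem $$(1+2\alpha^{-6})\left(\frac{\alpha'}{\alpha}\right)'+(1-4\alpha^{-6})\left(\frac{\alpha'}{\alpha}\right)^2-(\beta')^2=0,\qquad \beta''+2\left(\frac{\alpha'}{\alpha}\right)\beta'=0,$$ $$\alpha(0)=1,\quad\alpha'(0)=\alpha_0',\quad\beta(0)=0,\quad\beta'(0)=\beta_0'.$$ Let $e_0=3(\alpha_0')^2+(\beta_0')^2$ and $$\kappa(t)=\frac{3(\alpha'(t)/\alpha(t))^2-(\beta'(t))^2}{e_0(2\alpha(t)^{-2}+\alpha(t)^4)^{1/2}}.$$ If $\alpha_0'<0$ and $\beta_0'=0$, then $$\beta(t)\equiv0,\qquad\alpha''(t)>0\qquad(t\in\mathbb{R}),$$ $$0<\alpha'(t)+e_0^{1/2}\lesssim(1+|t|)^{-6},\quad t<0,$$ $$0<\alpha(t)-e_0^{1/2}|t|-\alpha_{-\infty}\lesssim(1+|t|)^{-5},\quad t<0,\quad\text{with}\quad\alpha_{-\infty}=1-\int_{-\infty}^0(\alpha'(s)+e_0^{1/2})\,ds,$$ $$0<(2e_0)^{1/2}-(\alpha(t)^{-2})'\lesssim(1+t)^{-3},\quad t>0,$$ $$0<\alpha(t)^{-2}-(2e_0)^{1/2}t-\alpha_\infty\lesssim(1+t)^{-2},\quad t>0,\quad\text{with}\quad\alpha_\infty=1-\int_0^\infty\bigl[(2e_0)^{1/2}-(\alpha(s)^{-2})'\bigr]ds.$$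 Finally, the curvature $\kappa$ is everywhere positive and $$\begin{cases}0<\kappa(t)\lesssim(1+|t|)^{-4},&t<0,\\ 0<\kappa(t)\lesssim(1+t)^{-5/2},&t>0.\end{cases}$$ By time reversal (replacing $\alpha(t)$, $\beta(t)$, $\kappa(t)$ by $\alpha(-t)$, $\beta(-t)$, $\kappa(-t)$), corresponding statements hold when $\alpha_0'>0$ and $\beta_0'=0$, namely $$\beta(t)\equiv0,\qquad\alpha''(t)>0\qquad(t\in\mathbb{R}),$$ $$0<e_0^{1/2}-\alpha'(t)\lesssim(1+t)^{-6},\quad t>0,$$ $$0<\alpha(t)-e_0^{1/2}t-a_{\infty}\lesssim(1+t)^{-5},\quad t>0,\quad\text{with}\quad a_{\infty}=1-\int_0^{\infty}(e_0^{1/2}-\alpha'(s))\,ds,$$ $$0<(2e_0)^{1/2}+(\alpha(t)^{-2})'\lesssim(1+|t|)^{-3},\quad t<0,$$ $$0<\alpha(t)^{-2}-(2e_0)^{1/2}|t|-a_{-\infty}\lesssim(1+|t|)^{-2},\quad t<0,\quad\text{with}\quad a_{-\infty}=1-\int_{-\infty}^0\bigl[(2e_0)^{1/2}+(\alpha(s)^{-2})'\bigr]ds,$$ and $\kappa$ is everywhere positive with $$\begin{cases}0<\kappa(t)\lesssim(1+t)^{-4},&t>0,\\ 0<\kappa(t)\lesssim(1+|t|)^{-5/2},&t<0.\end{cases}$$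
   Context: For nonnegative functions, $x\lesssim y$ means $x\le c\,y$ on the indicated range of $t$ with a constant $c>0$ independent of $t$. The system for $(\alpha,\beta)$ describes incompressible affine swirling flow, for which $\kappa$ is the (signed) curvature of the associated deformation gradient curve in the space of $3\times3$ matrices; only the formulas in the statement are needed. *)

theory Defs
  imports "HOL-Analysis.Analysis"
begin

definition C_infinity :: "(real \<Rightarrow> real) \<Rightarrow> bool" where
  "C_infinity f \<longleftrightarrow> (\<forall>n. (deriv ^^ n) f differentiable_on UNIV)"

definition swirl_solution ::
    "real \<Rightarrow> real \<Rightarrow> (real \<Rightarrow> real) \<Rightarrow> (real \<Rightarrow> real) \<Rightarrow> bool" where
  "swirl_solution a0' b0' \<alpha> \<beta> \<longleftrightarrow>
     C_infinity \<alpha> \<and> C_infinity \<beta> \<and> (\<forall>t. \<alpha> t > 0) \<and>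
     (\<forall>t. (1 + 2 * \<alpha> t powi (-6)) * deriv (\<lambda>s. deriv \<alpha> s / \<alpha> s) t
          + (1 - 4 * \<alpha> t powi (-6)) * (deriv \<alpha> t / \<alpha> t)\<^sup>2
          - (deriv \<beta> t)\<^sup>2 = 0) \<and>
     (\<forall>t. deriv (deriv \<beta>) t + 2 * (deriv \<alpha> t / \<alpha> t) * deriv \<beta> t = 0) \<and>
     \<alpha> 0 = 1 \<and> deriv \<alpha> 0 = a0' \<and> \<beta> 0 = 0 \<and> deriv \<beta> 0 = b0'"

definition swirl_energy :: "real \<Rightarrow> real \<Rightarrow> real" where
  "swirl_energy a0' b0' = 3 * a0'\<^sup>2 + b0'\<^sup>2"

definition swirl_curvature ::
    "real \<Rightarrow> (real \<Rightarrow> real) \<Rightarrow> (real \<Rightarrow> real) \<Rightarrow> real \<Rightarrow> real" where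
  "swirl_curvature e0 \<alpha> \<beta> t =
     (3 * (deriv \<alpha> t / \<alpha> t)\<^sup>2 - (deriv \<beta> t)\<^sup>2)
       / (e0 * sqrt (2 * \<alpha> t powi (-2) + \<alpha> t ^ 4))"

text \<open>The two-sided estimate written as 0 < f(t) \<lesssim> g(t) for t in S; the constant may
  depend on the functions f and g, but not on t.\<close>

definition pos_lesssim_on :: "real set \<Rightarrow> (real \<Rightarrow> real) \<Rightarrow> (real \<Rightarrow> real) \<Rightarrow> bool" where
  "pos_lesssim_on S f g \<longleftrightarrow> (\<forall>t\<in>S. 0 < f t) \<and> (\<exists>c>0. \<forall>t\<in>S. f t \<le> c * g t)"

end

theory Submission
  imports Defs
begin

text \<open>
  With \<open>b0' = 0\<close> the second equation says that \<open>\<alpha>\<^sup>2 \<beta>'\<close> is constant, so \<open>\<beta>\<close> vanishes and one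
  scalar equation for \<open>\<alpha>\<close> remains. It has the first integral
  \<open>\<alpha>' sqrt (1 + 2 \<alpha>\<^sup>-\<^sup>6)\<close>, whose square is the conserved energy. Its value is
  \<open>sqrt 3 a0'\<close>, that is \<open>\<plusminus> sqrt e0\<close> with the sign of \<open>a0'\<close>. Hence
  \<open>\<alpha>' = \<plusminus> sqrt e0 / sqrt (1 + 2 \<alpha>\<^sup>-\<^sup>6)\<close> never vanishes, and \<open>\<alpha>\<close> runs monotonically from one
  end, where it escapes to infinity, to the other, where it collapses to zero.

  Both ends obey the same equation. In the time direction in which it grows, \<open>y = \<alpha>\<close>
  satisfies \<open>y' = k / sqrt (1 + m y\<^sup>-\<^sup>n)\<close> with \<open>k = sqrt e0\<close>, \<open>m = 2\<close>, \<open>n = 6\<close>. In the opposite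
  direction \<open>y = \<alpha>\<^sup>-\<^sup>2\<close> satisfies it with \<open>k = sqrt (2 e0)\<close>, \<open>m = 1/2\<close>, \<open>n = 3\<close>
  (\<open>deriv_\<alpha>\<close> and \<open>inverse_square_deriv\<close>). So it is enough to study this equation for
  positive times, which is done in the locale \<open>saturating_growth\<close>.

  There \<open>y\<close> increases from 1 and therefore grows at least linearly; the defect
  \<open>k - y'\<close> is at most a multiple of \<open>y\<^sup>-\<^sup>n\<close>, so it is \<open>O((1 + t)\<^sup>-\<^sup>n)\<close>. It is thus integrable,
  the offset \<open>1 - \<integral>(k - y')\<close> is the limit of \<open>y - k t\<close>, and the distance to that limit
  is the tail of the integral, of order \<open>(1 + t)\<^sup>1\<^sup>-\<^sup>n\<close> (\<open>forward_asymptotics\<close>).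

  Finally, the first integral turns the curvature into an algebraic function of \<open>\<alpha>\<close> that is at most
  \<open>3 \<alpha>\<^sup>-\<^sup>4\<close> and at most \<open>3 \<alpha>\<^sup>5\<close>; the linear lower bounds on \<open>\<alpha>\<close> and \<open>\<alpha>\<^sup>-\<^sup>2\<close> give its decay.
\<close>

section \<open>Integrals with power law decay\<close>

text \<open>
  An antiderivative of a positive function with an integrable power law bound converges, and the
  bound integrates to a bound on the tail. The proof compares \<open>F\<close> with the tail \<open>G\<close> of the
  power law itself: \<open>F\<close> increases while \<open>F + G\<close> decreases, which yields boundedness of \<open>F\<close> and the
  tail estimate together.
\<close>

lemma power_law_tail:
  fixes F f :: "real \<Rightarrow> real" and n :: int
  assumes deriv: "\<And>t. (F has_real_derivative f t) (at t)"
    and pos: "\<And>t. 0 < f t"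
    and decay: "\<And>t. 0 \<le> t \<Longrightarrow> f t \<le> C * (1 + t) powi (- n)"
    and n: "2 \<le> n"
  obtains L where "(f has_integral (L - F 0)) {0..}"
    and "\<And>t. F t < L"
    and "\<And>t. 0 \<le> t \<Longrightarrow> L - F t \<le> C / (n - 1) * (1 + t) powi (1 - n)"
proof -
  define G where "G t = C / (n - 1) * (1 + t) powi (1 - n)" for t :: real
  have C: "0 < C"
    using pos[of 0] decay[of 0] by simp
  have G_nonneg: "0 \<le> G t" if "0 \<le> t" for t
    using that C n by (simp add: G_def)
  have G_deriv: "(G has_real_derivative - (C * (1 + t) powi (- n))) (at t)" if "0 \<le> t" for t
  proof -
    have "((\<lambda>t. (1 + t) powi (1 - n)) has_real_derivative (1 - n) * (1 + t) powi (- n)) (at t)"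
      using that by (auto intro!: derivative_eq_intros)
    from DERIV_cmult[OF this, of "C / (n - 1)"]
    have "(G has_real_derivative C / (n - 1) * ((1 - n) * (1 + t) powi (- n))) (at t)"
      unfolding G_def .
    moreover have "C / (n - 1) * ((1 - n) * p) = - (C * p)" for p :: real
      using n by (simp add: field_simps)
    ultimately show ?thesis by simp
  qed
  have F_less: "F s < F t" if "s < t" for s t
    using DERIV_pos_imp_increasing[OF that, of F] deriv pos by blast
  have "mono F"
    by (rule monoI) (metis F_less order_le_less)
  have FG_antimono: "F t + G t \<le> F s + G s" if "0 \<le> s" "s \<le> t" for s t
  proof (rule DERIV_nonpos_imp_nonincreasing[OF that(2)])
    fix x assume "s \<le> x" "x \<le> t"
    with that have x: "0 \<le> x" by simp
    show "\<exists>y. ((\<lambda>x. F x + G x) has_real_derivative y) (at x) \<and> y \<le> 0"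
      using DERIV_add[OF deriv G_deriv[OF x]] decay[OF x] by auto
  qed
  have F_le: "F t \<le> F s + G s" if "0 \<le> s" "s \<le> t" for s t
    using FG_antimono[OF that] G_nonneg[of t] that by simp
  obtain L where "(\<lambda>i. F (real i)) \<longlonglongrightarrow> L"
  proof (rule incseq_convergent[of "\<lambda>i. F (real i)" "F 0 + G 0"])
    show "incseq (\<lambda>i. F (real i))"
      using \<open>mono F\<close> by (simp add: incseq_def mono_def)
    show "\<forall>i. F (real i) \<le> F 0 + G 0"
      using F_le by simp
  qed
  then have lim: "(F \<longlongrightarrow> L) at_top"
    by (rule tendsto_at_topI_sequentially_real[OF \<open>mono F\<close>])
  have FTC: "(f has_integral (F b - F a)) {a..b}" if "a \<le> b" for a b
    using that deriv
    by (intro fundamental_theorem_of_calculus)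
       (auto simp: has_real_derivative_iff_has_vector_derivative[symmetric]
             intro: has_field_derivative_at_within)
  have "(f has_integral (L - F 0)) {0..}"
  proof (rule has_integral_to_inf)
    show "f integrable_on {0..y}" for y
      by (cases "0 \<le> y") (use FTC in \<open>auto simp: integrable_on_def\<close>)
    have "((\<lambda>y. F y - F 0) \<longlongrightarrow> L - F 0) at_top"
      by (intro tendsto_intros lim)
    moreover have "\<forall>\<^sub>F y in at_top. F y - F 0 = integral {0..y} f"
      using eventually_ge_at_top[of 0]
      by eventually_elim (metis FTC integral_unique)
    ultimately show "((\<lambda>y. integral {0..y} f) \<longlongrightarrow> L - F 0) at_top"
      by (rule Lim_transform_eventually)
  qed (use pos in \<open>auto intro: less_imp_le\<close>)
  moreover have "F t < L" for t
  proof -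
    have "F (t + 1) \<le> L"
      by (rule tendsto_lowerbound[OF lim])
         (use \<open>mono F\<close> in \<open>auto intro!: eventually_at_top_linorderI[of "t + 1"] dest: monoD\<close>)
    with F_less[of t "t + 1"] show ?thesis by simp
  qed
  moreover have "L - F t \<le> C / (n - 1) * (1 + t) powi (1 - n)" if "0 \<le> t" for t
  proof -
    have "L \<le> F t + G t"
      by (rule tendsto_upperbound[OF lim])
         (use F_le that in \<open>auto intro!: eventually_at_top_linorderI[of t]\<close>)
    then show ?thesis by (simp add: G_def)
  qed
  ultimately show ?thesis
    by (rule that)
qed

lemma one_minus_inverse_sqrt_le:
  fixes x :: real
  assumes "0 \<le> x"
  shows "1 - 1 / sqrt (1 + x) \<le> x"
proof -
  have "sqrt (1 + x) \<le> 1 + x"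
    using assms by (intro real_le_lsqrt) (auto simp: power2_eq_square algebra_simps)
  then have "1 / (1 + x) \<le> 1 / sqrt (1 + x)"
    using assms by (intro divide_left_mono) auto
  moreover have "1 - x \<le> 1 / (1 + x)"
    using assms by (simp add: field_simps)
  ultimately show ?thesis by simp
qed

section \<open>Growth that saturates at a limiting speed\<close>

text \<open>
  The parameters are the limiting speed \<open>k\<close>, the strength \<open>m\<close> of the correction and the order \<open>n\<close> at
  which it dies out; \<open>n \<ge> 2\<close> makes the correction integrable along linear growth.
\<close>

locale saturating_growth =
  fixes y :: "real \<Rightarrow> real" and k m :: real and n :: int
  assumes k: "0 < k" and m: "0 < m" and n: "2 \<le> n"
    and y0: "y 0 = 1"
    and y_pos: "\<And>t. 0 < y t"
    and y_deriv: "\<And>t. (y has_real_derivative k / sqrt (1 + m * y t powi (- n))) (at t)"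
begin

lemma deriv_y: "deriv y t = k / sqrt (1 + m * y t powi (- n))"
  by (rule DERIV_imp_deriv[OF y_deriv])

lemma deriv_y_less: "deriv y t < k"
proof -
  have "1 < sqrt (1 + m * y t powi (- n))"
    using m y_pos[of t] by simp
  then show ?thesis
    unfolding deriv_y using k by (simp add: divide_less_eq)
qed

lemma y_ge_1: "1 \<le> y t" if "0 \<le> t"
proof -
  have "y 0 \<le> y t"
    using that
  proof (rule DERIV_nonneg_imp_nondecreasing)
    fix x
    have "0 \<le> k / sqrt (1 + m * y x powi (- n))"
      using k m y_pos[of x] by simp
    with y_deriv show "\<exists>z. (y has_real_derivative z) (at x) \<and> 0 \<le> z"
      by blast
  qed
  then show ?thesis using y0 by simp
qed

text \<open>
  The speed grows with \<open>y\<close> and \<open>y \<ge> 1\<close> at positive times, so the speed never falls below its initial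
  value \<open>k / sqrt (1 + m)\<close>.
\<close>

lemma linear_lower_bound:
  obtains \<delta> where "0 < \<delta>" "\<And>t. 0 \<le> t \<Longrightarrow> \<delta> * (1 + t) \<le> y t"
proof
  define v where "v = k / sqrt (1 + m)"
  show "0 < min 1 v"
    using k m by (simp add: v_def)
  fix t :: real assume t: "0 \<le> t"
  have "y 0 - v * 0 \<le> y t - v * t"
    using t
  proof (rule DERIV_nonneg_imp_nondecreasing)
    fix x :: real assume x: "0 \<le> x"
    have "y x powi (- n) \<le> 1"
      using power_int_antimono[of 1 "y x" "- n"] y_ge_1[OF x] n by simp
    then have "v \<le> k / sqrt (1 + m * y x powi (- n))"
      unfolding v_def using k m y_pos[of x]
      by (intro divide_left_mono) (auto intro!: mult_pos_pos add_pos_pos)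
    moreover have "((\<lambda>t. y t - v * t) has_real_derivative
        k / sqrt (1 + m * y x powi (- n)) - v) (at x)"
      by (auto intro!: derivative_eq_intros y_deriv)
    ultimately show "\<exists>z. ((\<lambda>t. y t - v * t) has_real_derivative z) (at x) \<and> 0 \<le> z"
      by (meson diff_ge_0_iff_ge)
  qed
  then have "1 + v * t \<le> y t"
    using y0 by simp
  moreover have "min 1 v * t \<le> v * t"
    using t by (intro mult_right_mono) auto
  ultimately show "min 1 v * (1 + t) \<le> y t"
    by (simp add: algebra_simps)
qed

lemma speed_defect_bound:
  obtains C where "0 < C" "\<And>t. 0 \<le> t \<Longrightarrow> k - deriv y t \<le> C * (1 + t) powi (- n)"
proof -
  obtain \<delta> where \<delta>: "0 < \<delta>" "\<And>t. 0 \<le> t \<Longrightarrow> \<delta> * (1 + t) \<le> y t"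
    using linear_lower_bound by blast
  show thesis
  proof (rule that)
    show "0 < k * m * \<delta> powi (- n)"
      using k m \<delta> by simp
    fix t :: real assume t: "0 \<le> t"
    have "k - deriv y t = k * (1 - 1 / sqrt (1 + m * y t powi (- n)))"
      by (simp add: deriv_y right_diff_distrib)
    also have "\<dots> \<le> k * (m * y t powi (- n))"
      using k m y_pos[of t] by (intro mult_left_mono one_minus_inverse_sqrt_le) auto
    also have "\<dots> \<le> k * (m * (\<delta> * (1 + t)) powi (- n))"
      using \<delta> t k m n by (intro mult_left_mono power_int_antimono) auto
    finally show "k - deriv y t \<le> k * m * \<delta> powi (- n) * (1 + t) powi (- n)"
      by (simp add: power_int_mult_distrib mult.assoc)
  qed
qed

text \<open>
  The defect \<open>k - y'\<close> has the antiderivative \<open>k t - y\<close>, which is \<open>-1\<close> at time 0, so its limit \<open>L\<close> is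
  one less than the integral and the offset in the third estimate equals \<open>- L\<close>.
\<close>

lemma forward_asymptotics:
  shows speed: "pos_lesssim_on {0<..} (\<lambda>t. k - deriv y t) (\<lambda>t. (1 + t) powi (- n))"
    and speed_integrable: "(\<lambda>s. k - deriv y s) integrable_on {0..}"
    and position: "pos_lesssim_on {0<..}
          (\<lambda>t. y t - k * t - (1 - integral {0..} (\<lambda>s. k - deriv y s)))
          (\<lambda>t. (1 + t) powi (1 - n))"
proof -
  obtain C where C: "0 < C" "\<And>t. 0 \<le> t \<Longrightarrow> k - deriv y t \<le> C * (1 + t) powi (- n)"
    using speed_defect_bound by blast
  show "pos_lesssim_on {0<..} (\<lambda>t. k - deriv y t) (\<lambda>t. (1 + t) powi (- n))"
    unfolding pos_lesssim_on_def using C deriv_y_less by (auto intro!: exI[of _ C])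
  have "((\<lambda>t. k * t - y t) has_real_derivative k - deriv y t) (at t)" for t
    unfolding deriv_y by (auto intro!: derivative_eq_intros y_deriv)
  from power_law_tail[of "\<lambda>t. k * t - y t", OF this _ C(2) n] deriv_y_less
  obtain L where L: "((\<lambda>t. k - deriv y t) has_integral L + 1) {0..}"
    "\<And>t. k * t - y t < L"
    "\<And>t. 0 \<le> t \<Longrightarrow> L - (k * t - y t) \<le> C / (n - 1) * (1 + t) powi (1 - n)"
    by (auto simp: y0)
  show "(\<lambda>s. k - deriv y s) integrable_on {0..}"
    using L(1) by blast
  have "0 < C / (n - 1)"
    using C n by simp
  then show "pos_lesssim_on {0<..}
      (\<lambda>t. y t - k * t - (1 - integral {0..} (\<lambda>s. k - deriv y s)))
      (\<lambda>t. (1 + t) powi (1 - n))"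
    unfolding pos_lesssim_on_def integral_unique[OF L(1)] using L(2,3)
    by (auto simp: algebra_simps intro!: exI[of _ "C / (n - 1)"])
qed

end

section \<open>Time reversal\<close>

lemma pos_lesssim_on_reflect:
  assumes "pos_lesssim_on {0<..} (\<lambda>t. f (- t)) (\<lambda>t. g (- t))"
  shows "pos_lesssim_on {..<0} f g"
proof -
  obtain c where c: "c > 0" "\<And>t. 0 < t \<Longrightarrow> 0 < f (- t)" "\<And>t. 0 < t \<Longrightarrow> f (- t) \<le> c * g (- t)"
    using assms unfolding pos_lesssim_on_def by auto
  have "0 < f t \<and> f t \<le> c * g t" if "t < 0" for t
    using c(2,3)[of "- t"] that by simp
  then show ?thesis
    using c(1) unfolding pos_lesssim_on_def by auto
qed

lemma nonneg_integral_reflect: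
  fixes f :: "real \<Rightarrow> real"
  assumes "(\<lambda>s. f (- s)) integrable_on {0..}" and "\<And>s. 0 \<le> f s"
  shows "f integrable_on {..0}" and "integral {..0} f = integral {0..} (\<lambda>s. f (- s))"
proof -
  have "(\<lambda>s. f (- s)) absolutely_integrable_on {0..}"
    using assms by (intro nonnegative_absolutely_integrable_1) auto
  then have "f absolutely_integrable_on {..0} \<and>
      integral {..0} f = integral {0..} (\<lambda>s. f (- s))"
    using has_absolute_integral_reflect_real[of "{0..}" "{..0}" f "integral {0..} (\<lambda>s. f (- s))"]
    by (auto simp: image_subset_iff)
  then show "f integrable_on {..0}" "integral {..0} f = integral {0..} (\<lambda>s. f (- s))"
    by (auto intro: set_lebesgue_integral_eq_integral)
qed

text \<open>
  The conclusions are phrased through \<open>y\<close> itself, not its reflection, so that the limiting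
  speed of \<open>y\<close> in the distant past appears as \<open>- k\<close>.
\<close>

lemma saturating_growth_reflected:
  assumes "saturating_growth (\<lambda>t. y (- t)) k m n"
  shows reflected_speed:
      "pos_lesssim_on {..<0} (\<lambda>t. k + deriv y t) (\<lambda>t. (1 + \<bar>t\<bar>) powi (- n))"
    and reflected_speed_integrable: "(\<lambda>s. k + deriv y s) integrable_on {..0}"
    and reflected_position: "pos_lesssim_on {..<0}
          (\<lambda>t. y t - k * \<bar>t\<bar> - (1 - integral {..0} (\<lambda>s. k + deriv y s)))
          (\<lambda>t. (1 + \<bar>t\<bar>) powi (1 - n))"
proof -
  interpret r: saturating_growth "\<lambda>t. y (- t)" k m n
    by (rule assms)
  \<comment> \<open>Differentiability of \<open>y\<close> is recovered from that of its reflection by reflecting twice.\<close>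
  have slope: "deriv (\<lambda>t. y (- t)) t = - deriv y (- t)" for t
  proof -
    have "((\<lambda>t. y (- (- t))) has_real_derivative
        k / sqrt (1 + m * y (- (- (- t))) powi (- n)) * (- 1)) (at (- t))"
      using r.y_deriv[of "- (- t)"]
      by (intro DERIV_chain'[of uminus "- 1" "- t" UNIV "\<lambda>t. y (- t)"])
         (auto intro!: derivative_eq_intros)
    then have "deriv y (- t) = - (k / sqrt (1 + m * y (- t) powi (- n)))"
      by (intro DERIV_imp_deriv) simp
    then show ?thesis
      by (simp add: r.deriv_y)
  qed
  have nonneg: "0 \<le> k + deriv y s" for s
    using r.deriv_y_less[of "- s"] by (simp add: slope)
  show "pos_lesssim_on {..<0} (\<lambda>t. k + deriv y t) (\<lambda>t. (1 + \<bar>t\<bar>) powi (- n))"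
    using r.speed by (intro pos_lesssim_on_reflect) (simp add: slope pos_lesssim_on_def)
  note int = nonneg_integral_reflect[of "\<lambda>s. k + deriv y s", OF _ nonneg]
  show "(\<lambda>s. k + deriv y s) integrable_on {..0}"
    using r.speed_integrable by (intro int) (simp add: slope)
  have "integral {..0} (\<lambda>s. k + deriv y s) = integral {0..} (\<lambda>s. k - deriv (\<lambda>t. y (- t)) s)"
    using r.speed_integrable by (subst int(2)) (simp_all add: slope)
  then show "pos_lesssim_on {..<0}
      (\<lambda>t. y t - k * \<bar>t\<bar> - (1 - integral {..0} (\<lambda>s. k + deriv y s)))
      (\<lambda>t. (1 + \<bar>t\<bar>) powi (1 - n))"
    using r.position by (intro pos_lesssim_on_reflect) (simp add: pos_lesssim_on_def)
qed

lemma saturating_growth_reflectI: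
  assumes "0 < k" "0 < m" "2 \<le> n" "y 0 = 1" "\<And>t. 0 < y t"
    and deriv: "\<And>t. (y has_real_derivative - (k / sqrt (1 + m * y t powi (- n)))) (at t)"
  shows "saturating_growth (\<lambda>t. y (- t)) k m n"
proof
  fix t
  show "((\<lambda>t. y (- t)) has_real_derivative k / sqrt (1 + m * y (- t) powi (- n))) (at t)"
    using DERIV_chain'[OF DERIV_minus[OF DERIV_ident] deriv] by simp
qed (use assms in auto)

section \<open>Swirl-free solutions\<close>

lemma C_infinity_derivs:
  assumes "C_infinity f"
  shows "(f has_real_derivative deriv f t) (at t)"
    and "(deriv f has_real_derivative deriv (deriv f) t) (at t)"
proof -
  have "(deriv ^^ 0) f differentiable_on UNIV" "(deriv ^^ 1) f differentiable_on UNIV"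
    using assms unfolding C_infinity_def by blast+
  then show "(f has_real_derivative deriv f t) (at t)"
    "(deriv f has_real_derivative deriv (deriv f) t) (at t)"
    by (simp_all add: differentiable_on_def DERIV_deriv_iff_real_differentiable)
qed

locale swirl_free =
  fixes a :: real and \<alpha> \<beta> :: "real \<Rightarrow> real"
  assumes solution: "swirl_solution a 0 \<alpha> \<beta>" and a_nz: "a \<noteq> 0"
begin

lemma \<alpha>_pos: "0 < \<alpha> t" and \<alpha>_0: "\<alpha> 0 = 1" and deriv_\<alpha>_0: "deriv \<alpha> 0 = a"
  using solution by (auto simp: swirl_solution_def)

lemma \<alpha>_derivs [derivative_intros]:
  "(\<alpha> has_real_derivative deriv \<alpha> t) (at t)"
  "(deriv \<alpha> has_real_derivative deriv (deriv \<alpha>) t) (at t)"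
  using C_infinity_derivs[of \<alpha>] solution by (auto simp: swirl_solution_def)

lemma \<beta>_derivs [derivative_intros]:
  "(\<beta> has_real_derivative deriv \<beta> t) (at t)"
  "(deriv \<beta> has_real_derivative deriv (deriv \<beta>) t) (at t)"
  using C_infinity_derivs[of \<beta>] solution by (auto simp: swirl_solution_def)

lemma deriv_\<beta>_zero: "deriv \<beta> t = 0"
proof -
  have "((\<lambda>t. (\<alpha> t)\<^sup>2 * deriv \<beta> t) has_real_derivative 0) (at t)" for t
  proof -
    have "deriv (deriv \<beta>) t + 2 * (deriv \<alpha> t / \<alpha> t) * deriv \<beta> t = 0"
      using solution by (simp add: swirl_solution_def)
    then have "(\<alpha> t)\<^sup>2 * (deriv (deriv \<beta>) t + 2 * (deriv \<alpha> t / \<alpha> t) * deriv \<beta> t) = 0"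
      by simp
    then have "(\<alpha> t)\<^sup>2 * deriv (deriv \<beta>) t + 2 * \<alpha> t * deriv \<alpha> t * deriv \<beta> t = 0"
      using \<alpha>_pos[of t] by (simp add: distrib_left power2_eq_square mult.assoc)
    then show ?thesis
      using \<alpha>_derivs[of t] \<beta>_derivs[of t]
      by (auto intro!: derivative_eq_intros simp: algebra_simps)
  qed
  then have "(\<alpha> t)\<^sup>2 * deriv \<beta> t = (\<alpha> 0)\<^sup>2 * deriv \<beta> 0"
    by (intro DERIV_isconst_all) auto
  then show ?thesis
    using \<alpha>_pos[of t] solution by (simp add: swirl_solution_def)
qed

lemma \<beta>_zero: "\<beta> t = 0"
proof -
  have "\<beta> t = \<beta> 0"
    using \<beta>_derivs(1) by (intro DERIV_isconst_all) (simp add: deriv_\<beta>_zero)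
  then show ?thesis
    using solution by (simp add: swirl_solution_def)
qed

text \<open>
  The equation for \<open>\<alpha>\<close> solved for the second derivative: the terms \<open>(\<alpha>'/\<alpha>)\<^sup>2\<close> without
  the factor \<open>\<alpha>\<^sup>-\<^sup>6\<close> cancel, and convexity of \<open>\<alpha>\<close> becomes visible.
\<close>

lemma acceleration_eq:
  "(1 + 2 * \<alpha> t powi (-6)) * deriv (deriv \<alpha>) t = 6 * \<alpha> t powi (-7) * (deriv \<alpha> t)\<^sup>2"
proof -
  have ode: "(1 + 2 * \<alpha> t powi (-6)) * deriv (\<lambda>s. deriv \<alpha> s / \<alpha> s) t
      + (1 - 4 * \<alpha> t powi (-6)) * (deriv \<alpha> t / \<alpha> t)\<^sup>2 - (deriv \<beta> t)\<^sup>2 = 0"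
    using solution unfolding swirl_solution_def by blast
  have "((\<lambda>s. deriv \<alpha> s / \<alpha> s) has_real_derivative
      deriv (deriv \<alpha>) t / \<alpha> t - (deriv \<alpha> t / \<alpha> t)\<^sup>2) (at t)"
    using \<alpha>_pos[of t]
    by (auto intro!: derivative_eq_intros simp: field_simps power2_eq_square)
  then have "(1 + 2 * \<alpha> t powi (-6)) * (deriv (deriv \<alpha>) t / \<alpha> t - (deriv \<alpha> t / \<alpha> t)\<^sup>2)
      + (1 - 4 * \<alpha> t powi (-6)) * (deriv \<alpha> t / \<alpha> t)\<^sup>2 = 0"
    using ode deriv_\<beta>_zero[of t] by (simp add: DERIV_imp_deriv)
  moreover have "(1 + 2 * p) * (b / x - (c / x)\<^sup>2) + (1 - 4 * p) * (c / x)\<^sup>2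
      = ((1 + 2 * p) * b - 6 * (p / x) * c\<^sup>2) / x" if "x \<noteq> 0" for b c p x :: real
    using that by (simp add: field_simps power2_eq_square)
  moreover have "\<alpha> t powi (-7) = \<alpha> t powi (-6) / \<alpha> t"
    using \<alpha>_pos[of t] by (simp add: power_int_minus field_simps flip: power_Suc)
  ultimately show ?thesis
    using \<alpha>_pos[of t] by simp
qed

text \<open>
  The first integral is taken in the form linear in \<open>\<alpha>'\<close>, a signed square root of the energy,
  because its constancy determines the sign of \<open>\<alpha>'\<close> as well as its size.
\<close>

lemma deriv_\<alpha>: "deriv \<alpha> t = sqrt 3 * a / sqrt (1 + 2 * \<alpha> t powi (-6))"
proof -
  have pos: "0 < 1 + 2 * \<alpha> t powi (-6)" for t
    using \<alpha>_pos[of t] by (simp add: add_pos_pos)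
  have "((\<lambda>t. deriv \<alpha> t * sqrt (1 + 2 * \<alpha> t powi (-6))) has_real_derivative 0) (at t)" for t
  proof -
    define w where "w = sqrt (1 + 2 * \<alpha> t powi (-6))"
    have w: "0 < w" "w * w = 1 + 2 * \<alpha> t powi (-6)"
      using pos[of t] by (auto simp: w_def)
    have "((\<lambda>t. deriv \<alpha> t * sqrt (1 + 2 * \<alpha> t powi (-6))) has_real_derivative
        deriv (deriv \<alpha>) t * w + deriv \<alpha> t * (- 12 * \<alpha> t powi (-7) * deriv \<alpha> t / (2 * w))) (at t)"
      using \<alpha>_pos[of t] pos[of t] unfolding w_def
      by (auto intro!: derivative_eq_intros simp: field_simps)
    moreover have "deriv (deriv \<alpha>) t * w + deriv \<alpha> t * (- 12 * \<alpha> t powi (-7) * deriv \<alpha> t / (2 * w)) = 0"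
      using acceleration_eq[of t] w(1) unfolding w(2)[symmetric]
      by (simp add: field_simps power2_eq_square)
    ultimately show ?thesis by simp
  qed
  then have "deriv \<alpha> t * sqrt (1 + 2 * \<alpha> t powi (-6)) = deriv \<alpha> 0 * sqrt (1 + 2 * \<alpha> 0 powi (-6))"
    by (intro DERIV_isconst_all) auto
  then show ?thesis
    using pos[of t] by (simp add: \<alpha>_0 deriv_\<alpha>_0 field_simps)
qed

lemma deriv2_\<alpha>_pos: "0 < deriv (deriv \<alpha>) t"
proof -
  have pos: "0 < 1 + 2 * \<alpha> t powi (-6)"
    using \<alpha>_pos[of t] by (simp add: add_pos_pos)
  then have "deriv \<alpha> t \<noteq> 0"
    using a_nz by (simp add: deriv_\<alpha>)
  then have "0 < (1 + 2 * \<alpha> t powi (-6)) * deriv (deriv \<alpha>) t"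
    unfolding acceleration_eq using \<alpha>_pos[of t] by simp
  then show ?thesis
    using pos by (simp add: zero_less_mult_iff)
qed

text \<open>
  At the collapsing end \<open>\<alpha>\<^sup>-\<^sup>2\<close> is the quantity with finite limiting speed: the factor \<open>\<alpha>\<^sup>-\<^sup>3\<close>
  produced by the chain rule compensates the divergence of \<open>sqrt (1 + 2 \<alpha>\<^sup>-\<^sup>6)\<close>, since
  \<open>sqrt (1 + 2 \<alpha>\<^sup>-\<^sup>6) = sqrt 2 \<alpha>\<^sup>-\<^sup>3 sqrt (1 + \<alpha>\<^sup>6 / 2)\<close>.
\<close>

lemma inverse_square_deriv:
  "((\<lambda>t. \<alpha> t powi (-2)) has_real_derivative
      - (sqrt 2 * sqrt 3 * a / sqrt (1 + 1/2 * (\<alpha> t powi (-2)) powi (-3)))) (at t)"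
proof -
  define x where "x = \<alpha> t"
  have x: "0 < x" by (simp add: x_def \<alpha>_pos)
  have "sqrt (1 + 2 * x powi (-6)) = sqrt (2 / x ^ 6 * (1 + 1/2 * x ^ 6))"
    using x by (simp add: power_int_minus field_simps)
  also have "\<dots> = sqrt 2 / x ^ 3 * sqrt (1 + 1/2 * x ^ 6)"
  proof -
    have "sqrt (x ^ 6) = x ^ 3"
      using x by (intro real_sqrt_unique) (auto simp: power_mult[symmetric])
    then show ?thesis
      by (simp only: real_sqrt_mult real_sqrt_divide)
  qed
  finally have "sqrt (1 + 2 * x powi (-6)) = sqrt 2 / x ^ 3 * sqrt (1 + 1/2 * x ^ 6)" .
  moreover have "(x powi (-2)) powi (-3) = x ^ 6"
    by (simp flip: power_int_mult)
  moreover have "0 < sqrt (1 + 1/2 * x ^ 6)"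
    using x by (simp add: add_pos_pos)
  ultimately have "- 2 * x powi (-3) * (sqrt 3 * a / sqrt (1 + 2 * x powi (-6)))
      = - (sqrt 2 * sqrt 3 * a / sqrt (1 + 1/2 * (x powi (-2)) powi (-3)))"
    using x by (simp add: power_int_minus field_simps)
  moreover have "((\<lambda>t. \<alpha> t powi (-2)) has_real_derivative - 2 * x powi (-3) * deriv \<alpha> t) (at t)"
    using \<alpha>_pos[of t] by (auto intro!: derivative_eq_intros simp: x_def)
  ultimately show ?thesis
    by (simp add: deriv_\<alpha> x_def)
qed

section \<open>Curvature\<close>

abbreviation "e0 \<equiv> swirl_energy a 0"
abbreviation "\<kappa> \<equiv> swirl_curvature e0 \<alpha> \<beta>"

lemma sqrt_e0: "sqrt e0 = sqrt 3 * \<bar>a\<bar>" and sqrt_2_e0: "sqrt (2 * e0) = sqrt 2 * sqrt 3 * \<bar>a\<bar>"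
proof -
  have e0: "e0 = 3 * a\<^sup>2"
    by (simp add: swirl_energy_def)
  show "sqrt e0 = sqrt 3 * \<bar>a\<bar>" "sqrt (2 * e0) = sqrt 2 * sqrt 3 * \<bar>a\<bar>"
    unfolding e0 by (simp_all only: real_sqrt_mult real_sqrt_abs mult.assoc)
qed

lemma curvature_eq:
  "\<kappa> t = 3 * \<alpha> t powi (-2) / ((1 + 2 * \<alpha> t powi (-6)) * sqrt (2 * \<alpha> t powi (-2) + \<alpha> t ^ 4))"
proof -
  have pos: "0 < 1 + 2 * \<alpha> t powi (-6)"
    using \<alpha>_pos[of t] by (simp add: add_pos_pos)
  have "(deriv \<alpha> t)\<^sup>2 = 3 * a\<^sup>2 / (1 + 2 * \<alpha> t powi (-6))"
    using pos by (simp add: deriv_\<alpha> power_divide power_mult_distrib)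
  then have "3 * (deriv \<alpha> t / \<alpha> t)\<^sup>2 = e0 * (3 * \<alpha> t powi (-2) / (1 + 2 * \<alpha> t powi (-6)))"
    using \<alpha>_pos[of t] by (simp add: power_divide swirl_energy_def power_int_minus divide_simps)
  then show ?thesis
    using a_nz by (simp add: swirl_curvature_def deriv_\<beta>_zero swirl_energy_def)
qed

lemma curvature_pos: "0 < \<kappa> t"
  unfolding curvature_eq using \<alpha>_pos[of t]
  by (intro divide_pos_pos mult_pos_pos) (simp_all add: add_pos_pos)

text \<open>
  In each of the two sums in the denominator of \<open>curvature_eq\<close> one summand dominates: 1 and
  \<open>\<alpha>\<^sup>4\<close> when \<open>\<alpha>\<close> is large, \<open>2 \<alpha>\<^sup>-\<^sup>6\<close> and \<open>2 \<alpha>\<^sup>-\<^sup>2\<close> when \<open>\<alpha>\<close> is small. Keeping only the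
  former pair, or half of each member of the latter, gives the bounds, which hold for every \<open>\<alpha>\<close>.
\<close>

lemma curvature_le_inverse_fourth: "\<kappa> t \<le> 3 * \<alpha> t powi (-4)"
  and curvature_le_fifth: "\<kappa> t \<le> 3 * \<alpha> t ^ 5"
proof -
  define x where "x = \<alpha> t"
  have x: "0 < x" by (simp add: x_def \<alpha>_pos)
  have \<kappa>: "\<kappa> t = 3 * x powi (-2) / ((1 + 2 * x powi (-6)) * sqrt (2 * x powi (-2) + x ^ 4))"
    by (simp add: curvature_eq x_def)
  have bound: "\<kappa> t \<le> 3 * x powi (-2) / (u * v)"
    if "0 < u" "0 < v" "u \<le> 1 + 2 * x powi (-6)" "v\<^sup>2 \<le> 2 * x powi (-2) + x ^ 4" for u v
    unfolding \<kappa> using that x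
    by (intro divide_left_mono mult_mono real_le_rsqrt mult_pos_pos) (auto simp: add_pos_pos)
  have "\<kappa> t \<le> 3 * x powi (-2) / (1 * x\<^sup>2)"
    using x by (intro bound) (auto simp flip: power_mult)
  also have "\<dots> = 3 * x powi (-4)"
    using x by (simp add: power_int_minus field_simps flip: power_add)
  finally show "\<kappa> t \<le> 3 * \<alpha> t powi (-4)" by (simp add: x_def)
  have "\<kappa> t \<le> 3 * x powi (-2) / (x powi (-6) * inverse x)"
    using x by (intro bound) (auto simp: power_int_minus power_inverse)
  also have "\<dots> = 3 * x ^ 5"
    using x by (simp add: power_int_minus field_simps flip: power_add power_Suc)
  finally show "\<kappa> t \<le> 3 * \<alpha> t ^ 5" by (simp add: x_def)
qed

text \<open>
  The weight \<open>w\<close> stands for \<open>1 + t\<close> or \<open>1 + \<bar>t\<bar>\<close>, so that each of the next two lemmas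
  serves both time directions.
\<close>

lemma curvature_decay_escaping:
  assumes \<delta>: "0 < \<delta>" and w: "\<And>t. t \<in> S \<Longrightarrow> 0 < w t" "\<And>t. t \<in> S \<Longrightarrow> \<delta> * w t \<le> \<alpha> t"
  shows "pos_lesssim_on S \<kappa> (\<lambda>t. w t powi (-4))"
  unfolding pos_lesssim_on_def
proof (intro conjI ballI exI)
  fix t assume t: "t \<in> S"
  have "\<kappa> t \<le> 3 * \<alpha> t powi (-4)"
    by (rule curvature_le_inverse_fourth)
  also have "\<dots> \<le> 3 * (\<delta> * w t) powi (-4)"
    using \<delta> w[OF t] by (intro mult_left_mono power_int_antimono) auto
  finally show "\<kappa> t \<le> (3 * \<delta> powi (-4)) * w t powi (-4)"
    by (simp add: power_int_mult_distrib)
qed (use curvature_pos \<delta> in auto)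

lemma curvature_decay_collapsing:
  assumes \<delta>: "0 < \<delta>" and w: "\<And>t. t \<in> S \<Longrightarrow> 0 < w t" "\<And>t. t \<in> S \<Longrightarrow> \<delta> * w t \<le> \<alpha> t powi (-2)"
  shows "pos_lesssim_on S \<kappa> (\<lambda>t. w t powr (-5/2))"
  unfolding pos_lesssim_on_def
proof (intro conjI ballI exI)
  fix t assume t: "t \<in> S"
  have "\<kappa> t \<le> 3 * \<alpha> t ^ 5"
    by (rule curvature_le_fifth)
  also have "\<alpha> t ^ 5 = (\<alpha> t powi (-2)) powr (-5/2)"
    using \<alpha>_pos[of t] by (simp add: powr_real_of_int'[symmetric] powr_powr)
  also have "3 * (\<alpha> t powi (-2)) powr (-5/2) \<le> 3 * (\<delta> * w t) powr (-5/2)"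
    using \<delta> w[OF t] by (intro mult_left_mono powr_mono2') auto
  finally show "\<kappa> t \<le> (3 * \<delta> powr (-5/2)) * w t powr (-5/2)"
    using \<delta> w(1)[OF t] by (simp add: powr_mult)
qed (use curvature_pos \<delta> in auto)

end

section \<open>Asymptotics of swirl-free solutions\<close>

theorem theorem9:
  fixes a0' b0' e0 :: real and \<alpha> \<beta> \<kappa> :: "real \<Rightarrow> real"
  assumes "swirl_solution a0' b0' \<alpha> \<beta>"
    and "e0 = swirl_energy a0' b0'"
    and "\<kappa> = swirl_curvature e0 \<alpha> \<beta>"
  shows
    "(a0' < 0 \<and> b0' = 0 \<longrightarrow>
       (\<forall>t. \<beta> t = 0) \<and> (\<forall>t. deriv (deriv \<alpha>) t > 0) \<and>
       pos_lesssim_on {..<0} (\<lambda>t. deriv \<alpha> t + sqrt e0) (\<lambda>t. (1 + \<bar>t\<bar>) powi (-6)) \<and>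
       (\<lambda>s. deriv \<alpha> s + sqrt e0) integrable_on {..0} \<and>
       (let \<alpha>_minf = 1 - integral {..0} (\<lambda>s. deriv \<alpha> s + sqrt e0) in
         pos_lesssim_on {..<0} (\<lambda>t. \<alpha> t - sqrt e0 * \<bar>t\<bar> - \<alpha>_minf)
           (\<lambda>t. (1 + \<bar>t\<bar>) powi (-5))) \<and>
       pos_lesssim_on {0<..} (\<lambda>t. sqrt (2 * e0) - deriv (\<lambda>u. \<alpha> u powi (-2)) t)
         (\<lambda>t. (1 + t) powi (-3)) \<and>
       (\<lambda>s. sqrt (2 * e0) - deriv (\<lambda>u. \<alpha> u powi (-2)) s) integrable_on {0..} \<and>
       (let \<alpha>_inf = 1 - integral {0..} (\<lambda>s. sqrt (2 * e0) - deriv (\<lambda>u. \<alpha> u powi (-2)) s) in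
         pos_lesssim_on {0<..} (\<lambda>t. \<alpha> t powi (-2) - sqrt (2 * e0) * t - \<alpha>_inf)
           (\<lambda>t. (1 + t) powi (-2))) \<and>
       (\<forall>t. \<kappa> t > 0) \<and>
       pos_lesssim_on {..<0} \<kappa> (\<lambda>t. (1 + \<bar>t\<bar>) powi (-4)) \<and>
       pos_lesssim_on {0<..} \<kappa> (\<lambda>t. (1 + t) powr (-5/2)))
     \<and>
     (a0' > 0 \<and> b0' = 0 \<longrightarrow>
       (\<forall>t. \<beta> t = 0) \<and> (\<forall>t. deriv (deriv \<alpha>) t > 0) \<and>
       pos_lesssim_on {0<..} (\<lambda>t. sqrt e0 - deriv \<alpha> t) (\<lambda>t. (1 + t) powi (-6)) \<and>
       (\<lambda>s. sqrt e0 - deriv \<alpha> s) integrable_on {0..} \<and>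
       (let a_inf = 1 - integral {0..} (\<lambda>s. sqrt e0 - deriv \<alpha> s) in
         pos_lesssim_on {0<..} (\<lambda>t. \<alpha> t - sqrt e0 * t - a_inf)
           (\<lambda>t. (1 + t) powi (-5))) \<and>
       pos_lesssim_on {..<0} (\<lambda>t. sqrt (2 * e0) + deriv (\<lambda>u. \<alpha> u powi (-2)) t)
         (\<lambda>t. (1 + \<bar>t\<bar>) powi (-3)) \<and>
       (\<lambda>s. sqrt (2 * e0) + deriv (\<lambda>u. \<alpha> u powi (-2)) s) integrable_on {..0} \<and>
       (let a_minf = 1 - integral {..0} (\<lambda>s. sqrt (2 * e0) + deriv (\<lambda>u. \<alpha> u powi (-2)) s) in
         pos_lesssim_on {..<0} (\<lambda>t. \<alpha> t powi (-2) - sqrt (2 * e0) * \<bar>t\<bar> - a_minf)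
           (\<lambda>t. (1 + \<bar>t\<bar>) powi (-2))) \<and>
       (\<forall>t. \<kappa> t > 0) \<and>
       pos_lesssim_on {0<..} \<kappa> (\<lambda>t. (1 + t) powi (-4)) \<and>
       pos_lesssim_on {..<0} \<kappa> (\<lambda>t. (1 + \<bar>t\<bar>) powr (-5/2)))"
proof ((rule conjI; rule impI; elim conjE), goal_cases falling rising)
  case falling
  then have a: "a0' < 0" and b: "b0' = 0"
    by simp_all
  interpret swirl_free a0' \<alpha> \<beta>
    using assms(1) a b by unfold_locales auto
  have e0: "e0 = swirl_energy a0' 0" and \<kappa>: "\<kappa> = swirl_curvature (swirl_energy a0' 0) \<alpha> \<beta>"
    using assms(2,3) b by simp_all
  \<comment> \<open>Now \<open>\<alpha>\<close> decreases: it escapes to infinity in the past and collapses in the future.\<close>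
  have speeds: "sqrt 3 * a0' = - sqrt e0" "sqrt 2 * sqrt 3 * a0' = - sqrt (2 * e0)"
    using a by (simp_all add: e0 sqrt_e0 sqrt_2_e0)
  have past: "saturating_growth (\<lambda>t. \<alpha> (- t)) (sqrt e0) 2 6"
    using \<alpha>_derivs(1) a speeds(1)
    by (intro saturating_growth_reflectI)
       (simp_all add: \<alpha>_0 \<alpha>_pos deriv_\<alpha> e0 swirl_energy_def)
  interpret past: saturating_growth "\<lambda>t. \<alpha> (- t)" "sqrt e0" 2 6
    by (rule past)
  interpret future: saturating_growth "\<lambda>t. \<alpha> t powi (-2)" "sqrt (2 * e0)" "1/2" 3
    using inverse_square_deriv[unfolded speeds] a
    by unfold_locales (simp_all add: \<alpha>_0 \<alpha>_pos e0 swirl_energy_def)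
  obtain \<delta> where \<delta>: "0 < \<delta>" "\<And>t. 0 \<le> t \<Longrightarrow> \<delta> * (1 + t) \<le> \<alpha> (- t)"
    using past.linear_lower_bound by blast
  obtain \<epsilon> where \<epsilon>: "0 < \<epsilon>" "\<And>t. 0 \<le> t \<Longrightarrow> \<epsilon> * (1 + t) \<le> \<alpha> t powi (-2)"
    using future.linear_lower_bound by blast
  have "pos_lesssim_on {..<0} \<kappa> (\<lambda>t. (1 + \<bar>t\<bar>) powi (-4))"
    unfolding \<kappa> using \<delta>(2)[of "- t" for t]
    by (intro curvature_decay_escaping[OF \<delta>(1)]) auto
  moreover have "pos_lesssim_on {0<..} \<kappa> (\<lambda>t. (1 + t) powr (-5/2))"
    unfolding \<kappa> using \<epsilon>(2)
    by (intro curvature_decay_collapsing[OF \<epsilon>(1)]) auto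
  ultimately show ?case
    using \<beta>_zero deriv2_\<alpha>_pos curvature_pos future.forward_asymptotics
      reflected_speed[OF past] reflected_speed_integrable[OF past] reflected_position[OF past]
    by (simp add: \<kappa> Let_def add.commute[of "sqrt e0"])
next
  case rising
  then have a: "a0' > 0" and b: "b0' = 0"
    by simp_all
  interpret swirl_free a0' \<alpha> \<beta>
    using assms(1) a b by unfold_locales auto
  have e0: "e0 = swirl_energy a0' 0" and \<kappa>: "\<kappa> = swirl_curvature (swirl_energy a0' 0) \<alpha> \<beta>"
    using assms(2,3) b by simp_all
  have speeds: "sqrt 3 * a0' = sqrt e0" "sqrt 2 * sqrt 3 * a0' = sqrt (2 * e0)"
    using a by (simp_all add: e0 sqrt_e0 sqrt_2_e0)
  interpret future: saturating_growth \<alpha> "sqrt e0" 2 6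
    using \<alpha>_derivs(1) a speeds(1)
    by unfold_locales (simp_all add: \<alpha>_0 \<alpha>_pos deriv_\<alpha> e0 swirl_energy_def)
  have past: "saturating_growth (\<lambda>t. \<alpha> (- t) powi (-2)) (sqrt (2 * e0)) (1/2) 3"
    using inverse_square_deriv[unfolded speeds] a
    by (intro saturating_growth_reflectI[of _ _ _ "\<lambda>t. \<alpha> t powi (-2)"])
       (simp_all add: \<alpha>_0 \<alpha>_pos e0 swirl_energy_def)
  interpret past: saturating_growth "\<lambda>t. \<alpha> (- t) powi (-2)" "sqrt (2 * e0)" "1/2" 3
    by (rule past)
  obtain \<delta> where \<delta>: "0 < \<delta>" "\<And>t. 0 \<le> t \<Longrightarrow> \<delta> * (1 + t) \<le> \<alpha> t"
    using future.linear_lower_bound by blast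
  obtain \<epsilon> where \<epsilon>: "0 < \<epsilon>" "\<And>t. 0 \<le> t \<Longrightarrow> \<epsilon> * (1 + t) \<le> \<alpha> (- t) powi (-2)"
    using past.linear_lower_bound by blast
  have "pos_lesssim_on {0<..} \<kappa> (\<lambda>t. (1 + t) powi (-4))"
    unfolding \<kappa> using \<delta>(2)
    by (intro curvature_decay_escaping[OF \<delta>(1)]) auto
  moreover have "pos_lesssim_on {..<0} \<kappa> (\<lambda>t. (1 + \<bar>t\<bar>) powr (-5/2))"
    unfolding \<kappa> using \<epsilon>(2)[of "- t" for t]
    by (intro curvature_decay_collapsing[OF \<epsilon>(1)]) auto
  moreover note reflected_speed[of "\<lambda>t. \<alpha> t powi (-2)", OF past]
      reflected_speed_integrable[of "\<lambda>t. \<alpha> t powi (-2)", OF past]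
      reflected_position[of "\<lambda>t. \<alpha> t powi (-2)", OF past]
  ultimately show ?case
    using \<beta>_zero deriv2_\<alpha>_pos curvature_pos future.forward_asymptotics
    by (simp add: \<kappa> Let_def)
qed

end
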